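(* A (Hausdorff) Suslin tree $T$, with the order topology, is an $\omega_1$-compact, locally compact, first countable, f-Type I space containing no closed non-Lindelöf subspace which is f-narrow in $T$.
   Context: A tree is a partially ordered set in which the set of predecessors of each element is well ordered. A Suslin tree is a tree of height $\omega_1$ whose chains and antichains are at most countable. Trees carry the order (interval) topology: the topology with base the sets $\{z : x<z\le y\}$ together with the singletons of minimal elements. "Space" means Hausdorff topological space; a tree is Hausdorff iff two elements at a limit level with the same predecessors are equal. A space is $\omega_1$-compact if its closed discrete subspaces are at most countable. The longray $\mathbb{L}_{\ge 0}$ is $\omega_1\times[0,1)$ with the lexicographic order topology; $\alpha\in\omega_1$ is identified with $\langle\alpha,0\rangle$. A function into $\mathbb{L}_{\ge 0}$ is bounded if its range is contained in a strict initial segment. $T$ is f-Type I (functionally Type I, in itself) if there is a continuous $s:T\to\mathbb{L}_{\ge 0}$ such that $s^{-1}([0,\alpha])$ is Lindelöf for each $\alpha\in\omega_1$. A closed $D\subset T$ is f-narrow (functionally narrow) in $T$ if for every continuous $f:T\to\mathbb{L}_{\ge 0}$, either $f\upharpoonright D$ is bounded or $f^{-1}([0,\alpha])\cap D$ is Lindelöf for each $\alpha\in\omega_1$. *)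

theory Defs
  imports "HOL-Analysis.Analysis"
begin

unbundle cardinal_syntax

section \<open>The first uncountable ordinal and the long ray\<close>

typedef omega1 = "Field (cardSuc natLeq)"
proof -
  have "Card_order (cardSuc natLeq)"
    by (simp add: cardSuc_Card_order natLeq_Card_order)
  moreover have "natLeq <o cardSuc natLeq"
    by (simp add: cardSuc_greater natLeq_Card_order)
  ultimately have "Field (cardSuc natLeq) \<noteq> {}"
    using cardSuc_finite[OF natLeq_Card_order] Field_natLeq by auto
  then show ?thesis by auto
qed

lemma Well_order_cardSuc_natLeq: "Well_order (cardSuc natLeq)"
  using cardSuc_Card_order[OF natLeq_Card_order] card_order_on_well_order_on by blast

instantiation omega1 :: wellorder
begin

definition less_eq_omega1 :: "omega1 \<Rightarrow> omega1 \<Rightarrow> bool" where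
  "\<alpha> \<le> \<beta> \<longleftrightarrow> (Rep_omega1 \<alpha>, Rep_omega1 \<beta>) \<in> cardSuc natLeq"

definition less_omega1 :: "omega1 \<Rightarrow> omega1 \<Rightarrow> bool" where
  "(\<alpha> :: omega1) < \<beta> \<longleftrightarrow> \<alpha> \<le> \<beta> \<and> \<alpha> \<noteq> \<beta>"

instance
proof -
  let ?r = "cardSuc natLeq"
  have lin: "Linear_order ?r" and wf: "wf (?r - Id)"
    using Well_order_cardSuc_natLeq by (auto simp: well_order_on_def)
  have refl: "(a, a) \<in> ?r" if "a \<in> Field ?r" for a
    using lin that by (auto simp: order_on_defs refl_on_def)
  have trans: "trans ?r" and antisym: "antisym ?r" and total: "total_on (Field ?r) ?r"
    using lin by (auto simp: order_on_defs)
  show "OFCLASS(omega1, wellorder_class)"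
  proof
    fix x y z :: omega1
    show xx: "x \<le> x"
      by (simp add: less_eq_omega1_def refl Rep_omega1)
    show "x \<le> z" if "x \<le> y" "y \<le> z"
      using that trans unfolding less_eq_omega1_def trans_def by blast
    show as: "x = y" if "x \<le> y" "y \<le> x"
      using that antisym unfolding less_eq_omega1_def antisym_def
      by (meson Rep_omega1_inject)
    show "x \<le> y \<or> y \<le> x"
    proof (cases "x = y")
      case True
      then show ?thesis using xx by simp
    next
      case False
      then show ?thesis
        using total Rep_omega1 unfolding less_eq_omega1_def total_on_def
        by (metis Rep_omega1_inject)
    qed
    show "(x < y) = (x \<le> y \<and> \<not> y \<le> x)"
      using antisym refl Rep_omega1 unfolding less_omega1_def less_eq_omega1_def antisym_def
      by (metis Rep_omega1_inject)
  next
    fix P :: "omega1 \<Rightarrow> bool" and a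
    assume step: "\<And>x. (\<And>y. y < x \<Longrightarrow> P y) \<Longrightarrow> P x"
    have "wf (inv_image (?r - Id) Rep_omega1)"
      using wf by (rule wf_inv_image)
    then show "P a"
    proof (induction a rule: wf_induct_rule)
      case (less x)
      then show ?case
        using step[of x]
        by (auto simp: less_omega1_def less_eq_omega1_def inv_image_def Rep_omega1_inject)
    qed
  qed
qed

end

typedef longray = "UNIV \<times> {0..<1} :: (omega1 \<times> real) set"
  by (rule exI[of _ "(undefined, 0)"]) auto

instantiation longray :: linorder
begin

definition less_eq_longray :: "longray \<Rightarrow> longray \<Rightarrow> bool" where
  "p \<le> q \<longleftrightarrow> (let (\<alpha>, s) = Rep_longray p; (\<beta>, t) = Rep_longray q
               in \<alpha> < \<beta> \<or> \<alpha> = \<beta> \<and> s \<le> t)"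

definition less_longray :: "longray \<Rightarrow> longray \<Rightarrow> bool" where
  "p < q \<longleftrightarrow> (let (\<alpha>, s) = Rep_longray p; (\<beta>, t) = Rep_longray q
               in \<alpha> < \<beta> \<or> \<alpha> = \<beta> \<and> s < t)"

instance
proof
  fix x y z :: longray
  show "(x < y) = (x \<le> y \<and> \<not> y \<le> x)" "x \<le> x" "x \<le> y \<or> y \<le> x"
    by (auto simp: less_longray_def less_eq_longray_def Let_def split: prod.splits)
  show "x \<le> z" if "x \<le> y" "y \<le> z"
    using that by (auto simp: less_eq_longray_def Let_def split: prod.splits)
  show "x = y" if "x \<le> y" "y \<le> x"
    using that unfolding Rep_longray_inject[symmetric]
    by (auto simp: less_eq_longray_def Let_def split: prod.splits)
qed

end

instantiation longray :: linorder_topology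
begin

definition open_longray :: "longray set \<Rightarrow> bool" where
  "open_longray = generate_topology (range (\<lambda>a. {..<a}) \<union> range (\<lambda>a. {a<..}))"

instance
  by intro_classes (rule open_longray_def)

end

definition longray_of :: "omega1 \<Rightarrow> longray" where
  "longray_of \<alpha> = Abs_longray (\<alpha>, 0)"

section \<open>Trees\<close>

text \<open>A tree is given by its set of elements, ordered by the ambient partial order.\<close>

definition predecessors :: "'a::order set \<Rightarrow> 'a \<Rightarrow> 'a set" where
  "predecessors T x = {y \<in> T. y < x}"

definition order_rel :: "'a::order set \<Rightarrow> 'a rel" where
  "order_rel A = {(x, y). x \<in> A \<and> y \<in> A \<and> x \<le> y}"

definition tree :: "'a::order set \<Rightarrow> bool" where
  "tree T \<longleftrightarrow> (\<forall>x\<in>T. well_order_on (predecessors T x) (order_rel (predecessors T x)))"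

text \<open>Ordinals are represented by well-orders, up to the isomorphism relation \<open>=o\<close>.\<close>

definition level :: "'a::order set \<Rightarrow> 'b rel \<Rightarrow> 'a set" where
  "level T r = {x \<in> T. order_rel (predecessors T x) =o r}"

text \<open>The height is the least ordinal whose level is empty. Every ordinal smaller than \<open>r\<close>
  is represented by a well-order on the type underlying \<open>r\<close>.\<close>

definition has_height :: "'a::order set \<Rightarrow> 'b rel \<Rightarrow> bool" where
  "has_height T r \<longleftrightarrow>
     Well_order r \<and> level T r = {} \<and> (\<forall>s :: 'b rel. s <o r \<longrightarrow> level T s \<noteq> {})"

definition antichain :: "'a::order set \<Rightarrow> bool" where
  "antichain A \<longleftrightarrow> pairwise (\<lambda>x y. \<not> x \<le> y \<and> \<not> y \<le> x) A"

definition Suslin_tree :: "'a::order set \<Rightarrow> bool" where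
  "Suslin_tree T \<longleftrightarrow>
     tree T \<and> has_height T (cardSuc natLeq) \<and>
     (\<forall>C\<subseteq>T. Complete_Partial_Order.chain (\<le>) C \<longrightarrow> countable C) \<and>
     (\<forall>A\<subseteq>T. antichain A \<longrightarrow> countable A)"

definition tree_base :: "'a::order set \<Rightarrow> 'a set set" where
  "tree_base T =
     {{z \<in> T. x < z \<and> z \<le> y} | x y. x \<in> T \<and> y \<in> T} \<union>
     {{m} | m. m \<in> T \<and> predecessors T m = {}}"

definition tree_topology :: "'a::order set \<Rightarrow> 'a topology" where
  "tree_topology T = topology_generated_by (tree_base T)"

lemma topspace_tree_topology [simp]: "topspace (tree_topology T) = T"
proof -
  have "z \<in> \<Union> (tree_base T)" if "z \<in> T" for z
  proof (cases "predecessors T z = {}")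
    case True
    then show ?thesis using that by (auto simp: tree_base_def)
  next
    case False
    then obtain x where "x \<in> T" "x < z" by (auto simp: predecessors_def)
    then have "{w \<in> T. x < w \<and> w \<le> z} \<in> tree_base T" "z \<in> {w \<in> T. x < w \<and> w \<le> z}"
      using that by (auto simp: tree_base_def)
    then show ?thesis by blast
  qed
  moreover have "\<Union> (tree_base T) \<subseteq> T"
    by (auto simp: tree_base_def)
  ultimately show ?thesis
    unfolding tree_topology_def topology_generated_by_topspace by blast
qed

text \<open>In a tree the generating family is a base, not just a subbase.\<close>

lemma openin_tree_topology_iff:
  assumes "tree T"
  shows "openin (tree_topology T) U \<longleftrightarrow> (\<forall>z\<in>U. \<exists>B\<in>tree_base T. z \<in> B \<and> B \<subseteq> U)"
proof
  have cmp: "x \<le> x' \<or> x' \<le> x" if "z \<in> T" "x \<in> T" "x' \<in> T" "x < z" "x' < z" for x x' z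
  proof -
    have "total_on (predecessors T z) (order_rel (predecessors T z))"
      using assms that(1) by (auto simp: tree_def order_on_defs well_order_on_def)
    then show ?thesis
      using that unfolding total_on_def by (cases "x = x'") (auto simp: predecessors_def order_rel_def)
  qed
  have interval: "\<exists>x y. x \<in> T \<and> y \<in> T \<and> B = {w \<in> T. x < w \<and> w \<le> y}"
    if "B \<in> tree_base T" "z \<in> B" "B \<noteq> {z}" for B z
    using that unfolding tree_base_def by blast
  have inter: "\<exists>B\<in>tree_base T. z \<in> B \<and> B \<subseteq> B1 \<inter> B2"
    if B: "B1 \<in> tree_base T" "B2 \<in> tree_base T" and z: "z \<in> B1" "z \<in> B2" for B1 B2 z
  proof (cases "B1 = {z} \<or> B2 = {z}")
    case True
    then show ?thesis using B z by blast
  next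
    case False
    obtain x y where B1: "x \<in> T" "B1 = {w \<in> T. x < w \<and> w \<le> y}"
      using interval[OF B(1) z(1)] False by blast
    obtain x' y' where B2: "x' \<in> T" "B2 = {w \<in> T. x' < w \<and> w \<le> y'}"
      using interval[OF B(2) z(2)] False by blast
    have zT: "z \<in> T" "x < z" "x' < z" "z \<le> y" "z \<le> y'"
      using z unfolding B1(2) B2(2) by simp_all
    have "\<exists>u\<in>T. u < z \<and> x \<le> u \<and> x' \<le> u"
      using cmp[OF zT(1) B1(1) B2(1) zT(2,3)]
    proof
      assume "x \<le> x'"
      then show ?thesis using B2(1) zT(3) by (intro bexI[of _ x']) simp_all
    next
      assume "x' \<le> x"
      then show ?thesis using B1(1) zT(2) by (intro bexI[of _ x]) simp_all
    qed
    then obtain u where u: "u \<in> T" "u < z" "x \<le> u" "x' \<le> u" by blast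
    show ?thesis
    proof (intro bexI conjI)
      show "{w \<in> T. u < w \<and> w \<le> z} \<in> tree_base T"
        unfolding tree_base_def
        by (intro UnI1 CollectI exI[of _ u] exI[of _ z] conjI refl u(1) zT(1))
      show "z \<in> {w \<in> T. u < w \<and> w \<le> z}"
        using u(2) zT(1) by simp
      show "{w \<in> T. u < w \<and> w \<le> z} \<subseteq> B1 \<inter> B2"
      proof
        fix w assume "w \<in> {w \<in> T. u < w \<and> w \<le> z}"
        then have w: "w \<in> T" "u < w" "w \<le> z" by simp_all
        show "w \<in> B1 \<inter> B2"
          unfolding B1(2) B2(2)
          using w(1) le_less_trans[OF u(3) w(2)] le_less_trans[OF u(4) w(2)]
            order_trans[OF w(3) zT(4)] order_trans[OF w(3) zT(5)] by simp
      qed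
    qed
  qed
  assume "openin (tree_topology T) U"
  then have "generate_topology_on (tree_base T) U"
    by (simp add: tree_topology_def openin_topology_generated_by_iff)
  then show "\<forall>z\<in>U. \<exists>B\<in>tree_base T. z \<in> B \<and> B \<subseteq> U"
  proof induction
    case (Int a b)
    show ?case
    proof
      fix z assume "z \<in> a \<inter> b"
      then obtain B1 B2 where "B1 \<in> tree_base T" "z \<in> B1" "B1 \<subseteq> a"
        "B2 \<in> tree_base T" "z \<in> B2" "B2 \<subseteq> b"
        using Int.IH by blast
      then show "\<exists>B\<in>tree_base T. z \<in> B \<and> B \<subseteq> a \<inter> b"
        using inter[of B1 B2 z] by blast
    qed
  next
    case (UN K)
    show ?case
    proof
      fix z assume "z \<in> \<Union> K"
      then obtain k where k: "k \<in> K" "z \<in> k" by blast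
      then obtain B where B: "B \<in> tree_base T" "z \<in> B" "B \<subseteq> k"
        using UN.IH by meson
      then show "\<exists>B\<in>tree_base T. z \<in> B \<and> B \<subseteq> \<Union> K"
        using k(1) by (intro bexI[OF _ B(1)]) auto
    qed
  next
    case (Basis s)
    then show ?case by (meson subset_refl)
  qed simp
next
  assume R: "\<forall>z\<in>U. \<exists>B\<in>tree_base T. z \<in> B \<and> B \<subseteq> U"
  have "\<exists>V. openin (tree_topology T) V \<and> z \<in> V \<and> V \<subseteq> U" if zU: "z \<in> U" for z
  proof -
    obtain B where B: "B \<in> tree_base T" "z \<in> B" "B \<subseteq> U" using R zU by meson
    then show ?thesis
      unfolding tree_topology_def using topology_generated_by_Basis[OF B(1)] by (intro exI conjI)
  qed
  then show "openin (tree_topology T) U"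
    using openin_subopen[of "tree_topology T" U] by simp
qed

section \<open>Topological notions\<close>

definition omega1_compact :: "'a topology \<Rightarrow> bool" where
  "omega1_compact X \<longleftrightarrow>
     (\<forall>D. closedin X D \<and> subtopology X D = discrete_topology D \<longrightarrow> countable D)"

definition f_Type_I :: "'a topology \<Rightarrow> bool" where
  "f_Type_I X \<longleftrightarrow>
     (\<exists>s :: 'a \<Rightarrow> longray. continuous_map X euclidean s \<and>
        (\<forall>\<alpha>. Lindelof_space (subtopology X {x \<in> topspace X. s x \<le> longray_of \<alpha>})))"

definition f_narrow :: "'a topology \<Rightarrow> 'a set \<Rightarrow> bool" where
  "f_narrow X D \<longleftrightarrow>
     closedin X D \<and>
     (\<forall>f :: 'a \<Rightarrow> longray. continuous_map X euclidean f \<longrightarrow>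
        (\<exists>b. f ` D \<subseteq> {..<b}) \<or>
        (\<forall>\<alpha>. Lindelof_space (subtopology X {x \<in> D. f x \<le> longray_of \<alpha>})))"

end

(* Closed discrete sets: below each point such a set D is finite, because down-sets are compact,
   so D is the union of the countably many antichains of points with exactly n predecessors in D.

   The height function is continuous and has countable fibres, and a subset of T is Lindelof iff
   it is countable; this gives f-Type I.  If D is uncountable, then some cone {z. x < z} splits D
   into two uncountable pieces: otherwise the points whose cone contains uncountably many points
   of D form a chain C, hence a countable set, all but countably many points of D lie outside C,
   and they are covered by the cones of the countable antichain of minimal elements of T - C.
   As cones are clopen, the function equal to the height on the cone and constant off it is
   continuous; it shows that D is not f-narrow. *)

theory Submission
  imports Defs "HOL-Library.Countable_Set_Type"
begin

section \<open>Countable ordinals and the long ray\<close>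

text \<open>A proper initial segment of a cardinal has smaller cardinality, and a cardinality below
  \<open>cardSuc natLeq\<close> is at most \<open>natLeq\<close>.\<close>

lemma countable_lessThan_omega1: "countable {..<\<alpha> :: omega1}"
proof -
  let ?r = "cardSuc natLeq"
  have "|underS ?r (Rep_omega1 \<alpha>)| <o ?r"
    by (rule card_of_underS[OF cardSuc_Card_order[OF natLeq_Card_order] Rep_omega1])
  then have "|underS ?r (Rep_omega1 \<alpha>)| \<le>o natLeq"
    by (simp only: cardSuc_ordLeq_ordLess[OF natLeq_Card_order card_of_Card_order])
  then have "countable (underS ?r (Rep_omega1 \<alpha>))"
    by (simp add: countable_card_le_natLeq)
  moreover have "Rep_omega1 ` {..<\<alpha>} \<subseteq> underS ?r (Rep_omega1 \<alpha>)"
    by (auto simp: underS_def less_omega1_def less_eq_omega1_def Rep_omega1_inject)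
  ultimately have "countable (Rep_omega1 ` {..<\<alpha>})"
    by (rule countable_subset[rotated])
  moreover have "inj_on Rep_omega1 {..<\<alpha>}"
    by (simp add: inj_on_def Rep_omega1_inject)
  ultimately show ?thesis
    by (rule countable_image_inj_on)
qed

lemma countable_atMost_omega1: "countable {..\<alpha> :: omega1}"
proof -
  have "{..\<alpha>} = insert \<alpha> {..<\<alpha>}" by auto
  then show ?thesis by (simp add: countable_lessThan_omega1)
qed

lemma uncountable_UNIV_omega1: "uncountable (UNIV :: omega1 set)"
proof
  let ?r = "cardSuc natLeq"
  assume "countable (UNIV :: omega1 set)"
  then have "countable (Field ?r)"
    unfolding type_definition.Rep_range[OF type_definition_omega1, symmetric]
    by (rule countable_image)
  then have "|Field ?r| \<le>o natLeq"
    by (simp add: countable_card_le_natLeq)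
  then have "?r \<le>o natLeq"
    by (rule ordIso_ordLeq_trans[OF ordIso_symmetric[OF card_of_Field_ordIso[OF
          cardSuc_Card_order[OF natLeq_Card_order]]]])
  then show False
    using not_ordLess_ordLeq[OF cardSuc_greater[OF natLeq_Card_order]] by contradiction
qed

text \<open>Without a strict bound, the countable segments \<open>{..\<alpha>}\<close> with
  \<open>\<alpha>\<close> in \<open>A\<close> would exhaust the uncountable type
  \<open>omega1\<close>.\<close>

lemma countable_omega1_bounded:
  assumes "countable (A :: omega1 set)"
  shows "\<exists>\<beta>. \<forall>\<alpha>\<in>A. \<alpha> < \<beta>"
proof (rule ccontr)
  assume "\<not> ?thesis"
  then have "UNIV = (\<Union>\<alpha>\<in>A. {..\<alpha>})"
    by (auto simp: not_less)
  then have "countable (UNIV :: omega1 set)"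
    using assms countable_atMost_omega1 by (metis countable_UN)
  then show False using uncountable_UNIV_omega1 by blast
qed

lemma Rep_longray_of: "Rep_longray (longray_of \<alpha>) = (\<alpha>, 0)"
  by (simp add: longray_of_def Abs_longray_inverse)

lemma longray_of_le_iff: "longray_of \<alpha> \<le> longray_of \<beta> \<longleftrightarrow> \<alpha> \<le> \<beta>"
  by (auto simp: less_eq_longray_def Rep_longray_of)

text \<open>The real coordinate of \<open>a\<close> is at least that of
  \<open>longray_of \<alpha>\<close>, which is 0, so a strict inequality can only come from the
  ordinal coordinate.\<close>

lemma less_longray_of_iff: "a < longray_of \<alpha> \<longleftrightarrow> fst (Rep_longray a) < \<alpha>"
proof -
  have "snd (Rep_longray a) \<ge> 0" using Rep_longray[of a] by (auto simp: mem_Times_iff)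
  then show ?thesis
    by (auto simp: less_longray_def Rep_longray_of split: prod.splits)
qed

lemma longray_of_less_imp: "longray_of \<alpha> < b \<Longrightarrow> \<alpha> \<le> fst (Rep_longray b)"
  by (auto simp: less_longray_def Rep_longray_of split: prod.splits)

section \<open>The topology of a tree\<close>

lemma tree_comparable:
  assumes "tree T" "z \<in> T" "x \<in> T" "y \<in> T" "x \<le> z" "y \<le> z"
  shows "x \<le> y \<or> y \<le> x"
proof (cases "x = z \<or> y = z \<or> x = y")
  case False
  have "total_on (predecessors T z) (order_rel (predecessors T z))"
    using assms by (auto simp: tree_def order_on_defs well_order_on_def)
  then show ?thesis
    using assms False unfolding total_on_def
    by (simp add: predecessors_def order_rel_def) (metis le_less)
qed (use assms in auto)

text \<open>Well-ordering is given only below each single point. If \<open>Q\<close> meets the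
  predecessors of \<open>x\<close>, its least element there is minimal in \<open>Q\<close>, since
  whatever precedes it also precedes \<open>x\<close>; otherwise \<open>x\<close> itself is
  minimal.\<close>

lemma tree_wf:
  assumes "tree T"
  shows "wf {(y, x). y \<in> T \<and> x \<in> T \<and> y < x}"
proof (rule wfI_min)
  fix x :: 'a and Q
  assume "x \<in> Q"
  show "\<exists>z\<in>Q. \<forall>y. (y, z) \<in> {(y, x). y \<in> T \<and> x \<in> T \<and> y < x} \<longrightarrow> y \<notin> Q"
  proof (cases "x \<in> T \<and> Q \<inter> predecessors T x \<noteq> {}")
    case True
    let ?P = "predecessors T x"
    have "wf (order_rel ?P - Id)"
      using assms True by (auto simp: tree_def well_order_on_def)
    then obtain z where z: "z \<in> Q \<inter> ?P" "\<And>y. (y, z) \<in> order_rel ?P - Id \<Longrightarrow> y \<notin> Q \<inter> ?P"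
      using True wfE_min'[of "order_rel ?P - Id" "Q \<inter> ?P"] by blast
    have "y \<notin> Q" if "y \<in> T" "y < z" for y
      using z(1) z(2)[of y] that
      by (auto simp: order_rel_def predecessors_def dest: less_trans less_imp_le)
    then show ?thesis using z(1) by blast
  next
    case False
    then show ?thesis using \<open>x \<in> Q\<close> by (auto simp: predecessors_def)
  qed
qed

section \<open>Open sets and neighbourhoods\<close>

lemma openin_tree_interval:
  assumes "x \<in> T" "y \<in> T"
  shows "openin (tree_topology T) {z \<in> T. x < z \<and> z \<le> y}"
  unfolding tree_topology_def
  by (rule topology_generated_by_Basis) (use assms in \<open>auto simp: tree_base_def\<close>)

lemma openin_tree_minimal:
  assumes "y \<in> T" "predecessors T y = {}"
  shows "openin (tree_topology T) {y}"
  unfolding tree_topology_def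
  by (rule topology_generated_by_Basis) (use assms in \<open>auto simp: tree_base_def\<close>)

text \<open>A basic interval around \<open>z\<close> may be cut off on the right at
  \<open>z\<close>; the basic singletons are excluded because \<open>z\<close> is not
  minimal.\<close>

lemma tree_neighbourhood:
  assumes "tree T" "openin (tree_topology T) U" "z \<in> U" "predecessors T z \<noteq> {}"
  shows "\<exists>x\<in>T. x < z \<and> {w \<in> T. x < w \<and> w \<le> z} \<subseteq> U"
proof -
  obtain B where B: "B \<in> tree_base T" "z \<in> B" "B \<subseteq> U"
    using assms openin_tree_topology_iff by blast
  then consider x y where "x \<in> T" "y \<in> T" "B = {w \<in> T. x < w \<and> w \<le> y}"
    using assms(4) by (auto simp: tree_base_def)
  then show ?thesis
  proof cases
    case 1
    have "{w \<in> T. x < w \<and> w \<le> z} \<subseteq> B" using B(2) 1 by auto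
    then show ?thesis using B 1 by blast
  qed
qed

text \<open>Together with \<open>z\<close>, a down-set contains every interval ending at
  \<open>z\<close>. This covers principal down-sets, complements of cones and the sets where the
  height is small.\<close>

lemma openin_tree_downset:
  assumes "tree T" "U \<subseteq> T" "\<And>y z. z \<in> U \<Longrightarrow> y \<in> T \<Longrightarrow> y < z \<Longrightarrow> y \<in> U"
  shows "openin (tree_topology T) U"
  unfolding openin_tree_topology_iff[OF assms(1)]
proof
  fix z assume z: "z \<in> U"
  show "\<exists>B\<in>tree_base T. z \<in> B \<and> B \<subseteq> U"
  proof (cases "predecessors T z = {}")
    case True
    then show ?thesis using z assms(2) by (intro bexI[of _ "{z}"]) (auto simp: tree_base_def)
  next
    case False
    then obtain x where x: "x \<in> T" "x < z" by (auto simp: predecessors_def)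
    have "{w \<in> T. x < w \<and> w \<le> z} \<in> tree_base T"
      using x z assms(2) by (auto simp: tree_base_def)
    moreover have "{w \<in> T. x < w \<and> w \<le> z} \<subseteq> U"
      using z assms(3) by (auto simp: le_less)
    ultimately show ?thesis using x z assms(2) by (intro bexI[rotated]) auto
  qed
qed

lemma openin_tree_atMost:
  assumes "tree T"
  shows "openin (tree_topology T) {z \<in> T. z \<le> y}"
  by (rule openin_tree_downset[OF assms]) auto

lemma openin_tree_cone:
  assumes "tree T" "x \<in> T"
  shows "openin (tree_topology T) {z \<in> T. x < z}"
proof -
  have "{z \<in> T. x < z} = (\<Union>y\<in>T. {z \<in> T. x < z \<and> z \<le> y})" by auto
  then show ?thesis using openin_tree_interval[OF assms(2)] by auto
qed

lemma openin_tree_complement_cone: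
  assumes "tree T"
  shows "openin (tree_topology T) {z \<in> T. \<not> x < z}"
  by (rule openin_tree_downset[OF assms]) auto

text \<open>Well-founded induction on \<open>y\<close>: the member of the cover that contains
  \<open>y\<close> swallows an interval from some \<open>x < y\<close> up to \<open>y\<close>, and
  what is left lies below \<open>x\<close>.\<close>

lemma compactin_tree_atMost:
  assumes "tree T" "y \<in> T"
  shows "compactin (tree_topology T) {z \<in> T. z \<le> y}"
  using assms(2)
proof (induction y rule: wf_induct_rule[OF tree_wf[OF assms(1)]])
  case (1 y)
  show ?case
    unfolding compactin_def
  proof (intro conjI allI impI)
    show "{z \<in> T. z \<le> y} \<subseteq> topspace (tree_topology T)" by auto
    fix \<U>
    assume \<U>: "(\<forall>U\<in>\<U>. openin (tree_topology T) U) \<and> {z \<in> T. z \<le> y} \<subseteq> \<Union> \<U>"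
    then obtain U where U: "U \<in> \<U>" "y \<in> U" "openin (tree_topology T) U"
      using 1 by auto
    show "\<exists>\<F>. finite \<F> \<and> \<F> \<subseteq> \<U> \<and> {z \<in> T. z \<le> y} \<subseteq> \<Union> \<F>"
    proof (cases "predecessors T y = {}")
      case True
      then have "{z \<in> T. z \<le> y} \<subseteq> \<Union> {U}"
        using U by (auto simp: predecessors_def le_less)
      then show ?thesis using U by (intro exI[of _ "{U}"]) auto
    next
      case False
      then obtain x where x: "x \<in> T" "x < y" "{w \<in> T. x < w \<and> w \<le> y} \<subseteq> U"
        using tree_neighbourhood[OF assms(1) U(3,2)] by blast
      have "compactin (tree_topology T) {z \<in> T. z \<le> x}" using 1 x by auto
      moreover have "{z \<in> T. z \<le> x} \<subseteq> \<Union> \<U>" using \<U> x by auto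
      ultimately obtain \<F> where \<F>: "finite \<F>" "\<F> \<subseteq> \<U>" "{z \<in> T. z \<le> x} \<subseteq> \<Union> \<F>"
        using \<U> unfolding compactin_def by meson
      have "{z \<in> T. z \<le> y} \<subseteq> \<Union> (insert U \<F>)"
      proof
        fix w assume w: "w \<in> {z \<in> T. z \<le> y}"
        \<comment> \<open>Both \<open>w\<close> and \<open>x\<close> lie below \<open>y\<close>, so
          no point branches off between the two covered pieces.\<close>
        then have "w \<le> x \<or> x < w"
          using tree_comparable[OF assms(1), of y w x] 1 x by (auto simp: le_less)
        then show "w \<in> \<Union> (insert U \<F>)" using w x \<F> by blast
      qed
      then show ?thesis using \<F> U by (intro exI[of _ "insert U \<F>"]) auto
    qed
  qed
qed

text \<open>The down-set of \<open>x\<close> is both open and compact, so it serves as neighbourhood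
  and as compact set.\<close>

lemma locally_compact_space_tree:
  assumes "tree T"
  shows "locally_compact_space (tree_topology T)"
  unfolding locally_compact_space_def topspace_tree_topology
proof
  fix x assume "x \<in> T"
  then show "\<exists>U K. openin (tree_topology T) U \<and> compactin (tree_topology T) K \<and> x \<in> U \<and> U \<subseteq> K"
    using openin_tree_atMost[OF assms, of x] compactin_tree_atMost[OF assms]
    by (intro exI[of _ "{z \<in> T. z \<le> x}"]) auto
qed

section \<open>Trees with countable chains and antichains\<close>

lemma countable_predecessors:
  assumes "tree T" "\<And>C. C \<subseteq> T \<Longrightarrow> Complete_Partial_Order.chain (\<le>) C \<Longrightarrow> countable C"
    and "y \<in> T"
  shows "countable {z \<in> T. z \<le> y}"
  by (rule assms(2))
    (use tree_comparable[OF assms(1,3)] in \<open>auto simp: Complete_Partial_Order.chain_def\<close>)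

text \<open>At a non-minimal \<open>y\<close> the intervals ending at \<open>y\<close> form a
  neighbourhood base indexed by the predecessors of \<open>y\<close>, which form a countable
  chain.\<close>

lemma first_countable_tree:
  assumes "tree T" "\<And>C. C \<subseteq> T \<Longrightarrow> Complete_Partial_Order.chain (\<le>) C \<Longrightarrow> countable C"
  shows "first_countable (tree_topology T)"
  unfolding first_countable_def topspace_tree_topology
proof
  fix y assume y: "y \<in> T"
  show "\<exists>\<B>. countable \<B> \<and> (\<forall>V\<in>\<B>. openin (tree_topology T) V) \<and>
      (\<forall>U. openin (tree_topology T) U \<and> y \<in> U \<longrightarrow> (\<exists>V\<in>\<B>. y \<in> V \<and> V \<subseteq> U))"
  proof (cases "predecessors T y = {}")
    case True
    then show ?thesis
      using openin_tree_minimal[OF y] by (intro exI[of _ "{{y}}"]) auto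
  next
    case False
    let ?B = "(\<lambda>x. {w \<in> T. x < w \<and> w \<le> y}) ` predecessors T y"
    have "countable (predecessors T y)"
      by (rule countable_subset[OF _ countable_predecessors[OF assms y]])
        (auto simp: predecessors_def)
    moreover have "\<forall>V\<in>?B. openin (tree_topology T) V"
      using openin_tree_interval y by (auto simp: predecessors_def)
    moreover have "\<exists>V\<in>?B. y \<in> V \<and> V \<subseteq> U" if U: "openin (tree_topology T) U" "y \<in> U" for U
      using tree_neighbourhood[OF assms(1) U False] y by (auto simp: predecessors_def)
    ultimately show ?thesis
      using y by (intro exI[of _ ?B] conjI allI impI countable_image) simp_all
  qed
qed

text \<open>The down-sets of the points of \<open>S\<close> are an open cover of \<open>S\<close> by
  countable sets, and a countable subcover has countable union.\<close>

lemma Lindelof_tree_imp_countable: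
  assumes "tree T" "\<And>C. C \<subseteq> T \<Longrightarrow> Complete_Partial_Order.chain (\<le>) C \<Longrightarrow> countable C"
    and "S \<subseteq> T" "Lindelof_space (subtopology (tree_topology T) S)"
  shows "countable S"
proof -
  let ?U = "(\<lambda>y. {z \<in> T. z \<le> y}) ` S"
  have "S \<subseteq> \<Union> ?U" using assms(3) by auto
  moreover have "\<forall>U\<in>?U. openin (tree_topology T) U"
    using openin_tree_atMost[OF assms(1)] by auto
  ultimately have "\<exists>\<V>. countable \<V> \<and> \<V> \<subseteq> ?U \<and> S \<subseteq> \<Union> \<V>"
    using assms(4) Lindelof_space_subtopology_subset[of S "tree_topology T"] assms(3)
    unfolding topspace_tree_topology by presburger
  then obtain \<V> where V: "countable \<V>" "\<V> \<subseteq> ?U" "S \<subseteq> \<Union> \<V>" by (elim exE conjE)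
  have "countable (\<Union>U\<in>\<V>. U)"
  proof (rule countable_UN[OF V(1)])
    fix U assume "U \<in> \<V>"
    then obtain y where "y \<in> T" "U = {z \<in> T. z \<le> y}" using V(2) assms(3) by blast
    then show "countable U" using countable_predecessors[OF assms(1,2)] by simp
  qed
  then show ?thesis using V(3) by (simp add: countable_subset)
qed

text \<open>Distinct comparable points have distinct values. This is applied to the counting
  function of a closed discrete set and to the height.\<close>

lemma antichain_strict_mono_fibre:
  fixes h :: "'a::order \<Rightarrow> 'b::order"
  assumes "\<And>x y. x \<in> A \<Longrightarrow> y \<in> A \<Longrightarrow> x < y \<Longrightarrow> h x < h y"
  shows "antichain {x \<in> A. h x = c}"
  unfolding antichain_def pairwise_def using assms by (force simp: le_less)

lemma omega1_compact_tree:
  assumes "tree T" "\<And>A. A \<subseteq> T \<Longrightarrow> antichain A \<Longrightarrow> countable A"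
  shows "omega1_compact (tree_topology T)"
  unfolding omega1_compact_def
proof (intro allI impI, elim conjE)
  fix D
  assume D: "closedin (tree_topology T) D"
    and disc: "subtopology (tree_topology T) D = discrete_topology D"
  have DT: "D \<subseteq> T" using closedin_subset[OF D] by simp
  \<comment> \<open>For \<open>x\<close> in \<open>D\<close> the point \<open>x\<close> is counted
    too, so \<open>h x\<close> is one more than the number of its predecessors in
    \<open>D\<close>.\<close>
  define h where "h x = card {z \<in> D. z \<le> x}" for x
  have fin: "finite {z \<in> D. z \<le> x}" if "x \<in> T" for x
  proof -
    \<comment> \<open>A closed part of a compact set is compact, and a compact subset of a discrete
      space is finite.\<close>
    have "compactin (tree_topology T) (D \<inter> {z \<in> T. z \<le> x})"
      by (rule closed_Int_compactin[OF D compactin_tree_atMost[OF assms(1) that]])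
    then have "compactin (discrete_topology D) (D \<inter> {z \<in> T. z \<le> x})"
      unfolding disc[symmetric] compactin_subtopology by auto
    then have "finite (D \<inter> {z \<in> T. z \<le> x})" by (simp add: compactin_discrete_topology)
    then show ?thesis by (rule finite_subset[rotated]) (use DT in auto)
  qed
  have "h x < h y" if "x \<in> D" "y \<in> D" "x < y" for x y
  proof -
    have "{z \<in> D. z \<le> x} \<subseteq> {z \<in> D. z \<le> y}" "y \<in> {z \<in> D. z \<le> y} - {z \<in> D. z \<le> x}"
      using that by auto
    then show ?thesis
      unfolding h_def using that DT by (intro psubset_card_mono[OF fin]) blast+
  qed
  then have "antichain {x \<in> D. h x = n}" for n
    by (rule antichain_strict_mono_fibre)
  then have "countable {x \<in> D. h x = n}" for n
    using DT by (intro assms(2)) blast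
  then have "countable (\<Union>n. {x \<in> D. h x = n})"
    by simp
  then show "countable D" by (rule countable_subset[rotated]) auto
qed

lemma uncountable_split_by_cone:
  assumes "tree T" "\<And>C. C \<subseteq> T \<Longrightarrow> Complete_Partial_Order.chain (\<le>) C \<Longrightarrow> countable C"
    and "\<And>A. A \<subseteq> T \<Longrightarrow> antichain A \<Longrightarrow> countable A"
    and "D \<subseteq> T" "uncountable D"
  shows "\<exists>x\<in>T. uncountable {z \<in> D. x < z} \<and> uncountable {z \<in> D. \<not> x < z}"
proof (rule ccontr)
  assume "\<not> ?thesis"
  then have split: "countable {z \<in> D. \<not> x < z}" if "x \<in> T" "uncountable {z \<in> D. x < z}" for x
    using that by blast
  define C where "C = {x \<in> T. uncountable {z \<in> D. x < z}}"
  have "x \<le> y \<or> y \<le> x" if "x \<in> C" "y \<in> C" for x y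
  proof -
    \<comment> \<open>Each of the two cones misses only countably many points of \<open>D\<close>,
      so some \<open>d\<close> in \<open>D\<close> lies in both; then \<open>x\<close> and
      \<open>y\<close> are comparable as predecessors of \<open>d\<close>.\<close>
    have "countable ({z \<in> D. \<not> x < z} \<union> {z \<in> D. \<not> y < z})"
      using split that by (auto simp: C_def)
    then have "\<not> D \<subseteq> {z \<in> D. \<not> x < z} \<union> {z \<in> D. \<not> y < z}"
      using assms(5) by (meson countable_subset)
    then obtain d where "d \<in> D" "x < d" "y < d" by blast
    then show ?thesis
      using tree_comparable[OF assms(1), of d x y] that assms(4) by (auto simp: C_def)
  qed
  then have "countable C"
    by (intro assms(2)) (auto simp: Complete_Partial_Order.chain_def C_def)
  define A where "A = {a \<in> T - C. \<forall>b\<in>T - C. \<not> b < a}"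
  have "antichain A"
    unfolding antichain_def pairwise_def A_def by (auto simp: le_less)
  then have "countable A" by (intro assms(3)) (auto simp: A_def)
  \<comment> \<open>The cone of \<open>a\<close> is countable on \<open>D\<close> because
    \<open>a\<close> is not in \<open>C\<close>. Cones are strict, so \<open>a\<close> itself has to
    be added.\<close>
  moreover have "countable (insert a {z \<in> D. a < z})" if "a \<in> A" for a
    using that by (auto simp: A_def C_def)
  ultimately have "countable (C \<union> (\<Union>a\<in>A. insert a {z \<in> D. a < z}))"
    using \<open>countable C\<close> by blast
  moreover have "D \<subseteq> C \<union> (\<Union>a\<in>A. insert a {z \<in> D. a < z})"
  proof
    fix d assume d: "d \<in> D"
    show "d \<in> C \<union> (\<Union>a\<in>A. insert a {z \<in> D. a < z})"
    proof (cases "d \<in> C")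
      case False
      \<comment> \<open>A minimal point of the part of \<open>T - C\<close> below \<open>d\<close>
        is minimal in all of \<open>T - C\<close>, since anything smaller is also below
        \<open>d\<close>.\<close>
      obtain a where a: "a \<in> {z \<in> T - C. z \<le> d}"
        "\<And>b. (b, a) \<in> {(y, x). y \<in> T \<and> x \<in> T \<and> y < x} \<Longrightarrow> b \<notin> {z \<in> T - C. z \<le> d}"
        using wfE_min[OF tree_wf[OF assms(1)], of d "{z \<in> T - C. z \<le> d}"] d False assms(4)
        by blast
      have "\<not> b < a" if "b \<in> T - C" for b
        using a(1) a(2)[of b] that by auto
      then have "a \<in> A" "a \<le> d" using a(1) by (auto simp: A_def)
      then show ?thesis using d by (auto simp: le_less)
    qed simp
  qed
  ultimately show False using assms(5) countable_subset by blast
qed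

section \<open>The height function\<close>

text \<open>The height as an element of \<open>omega1\<close> rather than a well-order up to
  isomorphism: the least strict upper bound of the heights of the predecessors. When chains are
  countable such a bound exists at every point of \<open>T\<close>.\<close>

definition tree_rank :: "'a::order set \<Rightarrow> 'a \<Rightarrow> omega1" where
  "tree_rank T = wfrec {(y, x). y \<in> T \<and> x \<in> T \<and> y < x}
     (\<lambda>h x. LEAST \<alpha>. \<forall>y\<in>predecessors T x. h y < \<alpha>)"

lemma tree_rank_unfold:
  assumes "tree T" "x \<in> T"
  shows "tree_rank T x = (LEAST \<alpha>. \<forall>y\<in>predecessors T x. tree_rank T y < \<alpha>)"
proof -
  let ?R = "{(y, x). y \<in> T \<and> x \<in> T \<and> y < x}"
  have "tree_rank T x =
      (LEAST \<alpha>. \<forall>y\<in>predecessors T x. cut (tree_rank T) ?R x y < \<alpha>)"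
    unfolding tree_rank_def by (subst wfrec[OF tree_wf[OF assms(1)]]) (rule refl)
  moreover have "cut (tree_rank T) ?R x y = tree_rank T y" if "y \<in> predecessors T x" for y
    by (rule cut_apply) (use that assms in \<open>auto simp: predecessors_def\<close>)
  ultimately show ?thesis by (simp cong: ball_cong)
qed

lemma tree_rank_le:
  assumes "tree T" "x \<in> T" "\<And>y. y \<in> T \<Longrightarrow> y < x \<Longrightarrow> tree_rank T y < \<alpha>"
  shows "tree_rank T x \<le> \<alpha>"
  unfolding tree_rank_unfold[OF assms(1,2)]
  by (rule Least_le) (use assms(3) in \<open>auto simp: predecessors_def\<close>)

text \<open>The countably many ranks below \<open>x\<close> have a strict bound in
  \<open>omega1\<close>, so the \<open>LEAST\<close> defining the rank of \<open>x\<close> is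
  attained.\<close>

lemma tree_rank_strict_mono:
  assumes "tree T" "\<And>C. C \<subseteq> T \<Longrightarrow> Complete_Partial_Order.chain (\<le>) C \<Longrightarrow> countable C"
    and "x \<in> T" "y \<in> T" "y < x"
  shows "tree_rank T y < tree_rank T x"
proof -
  have "countable (predecessors T x)"
    by (rule countable_subset[OF _ countable_predecessors[OF assms(1,2,3)]])
      (auto simp: predecessors_def)
  then obtain \<beta> where "\<forall>\<alpha>\<in>tree_rank T ` predecessors T x. \<alpha> < \<beta>"
    using countable_omega1_bounded countable_image by metis
  then have "\<forall>y\<in>predecessors T x. tree_rank T y < \<beta>" by blast
  then have "\<forall>y\<in>predecessors T x. tree_rank T y < tree_rank T x"
    unfolding tree_rank_unfold[OF assms(1,3)]
    by (rule LeastI[of "\<lambda>\<alpha>. \<forall>y\<in>predecessors T x. tree_rank T y < \<alpha>"])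
  then show ?thesis using assms by (auto simp: predecessors_def)
qed

text \<open>Each fibre of the rank is an antichain, and only countably many ordinals are at most
  \<open>\<alpha>\<close>.\<close>

lemma countable_tree_rank_le:
  assumes "tree T" "\<And>C. C \<subseteq> T \<Longrightarrow> Complete_Partial_Order.chain (\<le>) C \<Longrightarrow> countable C"
    and "\<And>A. A \<subseteq> T \<Longrightarrow> antichain A \<Longrightarrow> countable A"
  shows "countable {x \<in> T. tree_rank T x \<le> \<alpha>}"
proof -
  have "antichain {x \<in> T. tree_rank T x = \<beta>}" for \<beta>
    by (rule antichain_strict_mono_fibre) (rule tree_rank_strict_mono[OF assms(1,2)])
  then have "countable (\<Union>\<beta>\<in>{..\<alpha>}. {x \<in> T. tree_rank T x = \<beta>})"
    using assms(3) countable_atMost_omega1 by (intro countable_UN) auto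
  then show ?thesis by (rule countable_subset[rotated]) auto
qed

lemma continuous_map_tree_rank:
  assumes "tree T" "\<And>C. C \<subseteq> T \<Longrightarrow> Complete_Partial_Order.chain (\<le>) C \<Longrightarrow> countable C"
  shows "continuous_map (tree_topology T) euclidean (\<lambda>x. longray_of (tree_rank T x))"
  unfolding continuous_map_upper_lower_semicontinuous_lt topspace_tree_topology
proof (intro conjI allI)
  fix a
  \<comment> \<open>The map takes only values \<open>longray_of \<beta>\<close>, and such a value
    exceeds \<open>a\<close> exactly when \<open>\<beta>\<close> exceeds the ordinal coordinate of
    \<open>a\<close>.\<close>
  let ?\<alpha> = "fst (Rep_longray a)"
  let ?U = "{x \<in> T. ?\<alpha> < tree_rank T x}"
  have "openin (tree_topology T) ?U"
  proof (subst openin_subopen, intro ballI)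
    fix x assume x: "x \<in> ?U"
    then have "\<not> tree_rank T x \<le> ?\<alpha>" by auto
    \<comment> \<open>Ranks do not jump: if all ranks below \<open>x\<close> were under
      \<open>?\<alpha>\<close>, the rank of \<open>x\<close> would be at most
      \<open>?\<alpha>\<close>. Strict monotonicity then puts everything above \<open>y\<close> into
      \<open>?U\<close>.\<close>
    then obtain y where y: "y \<in> T" "y < x" "?\<alpha> \<le> tree_rank T y"
      using tree_rank_le[OF assms(1), of x ?\<alpha>] x not_less by blast
    have "?\<alpha> < tree_rank T w" if "w \<in> T" "y < w" for w
      using tree_rank_strict_mono[OF assms that(1) y(1) that(2)] y(3) by (rule le_less_trans[rotated])
    then have "{w \<in> T. y < w \<and> w \<le> x} \<subseteq> ?U" by blast
    then show "\<exists>V. openin (tree_topology T) V \<and> x \<in> V \<and> V \<subseteq> ?U"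
      using openin_tree_interval[OF y(1), of x] x y
      by (intro exI[of _ "{w \<in> T. y < w \<and> w \<le> x}"]) auto
  qed
  then show "openin (tree_topology T) {x \<in> T. a < longray_of (tree_rank T x)}"
    by (simp add: less_longray_of_iff)
  show "openin (tree_topology T) {x \<in> T. longray_of (tree_rank T x) < a}"
  proof (rule openin_tree_downset[OF assms(1)])
    fix y z
    assume z: "z \<in> {x \<in> T. longray_of (tree_rank T x) < a}" and y: "y \<in> T" "y < z"
    then have "longray_of (tree_rank T y) \<le> longray_of (tree_rank T z)"
      using tree_rank_strict_mono[OF assms, of z y] by (simp add: longray_of_le_iff)
    then show "y \<in> {x \<in> T. longray_of (tree_rank T x) < a}" using z y by auto
  qed auto
qed

lemma f_Type_I_tree:
  assumes "tree T" "\<And>C. C \<subseteq> T \<Longrightarrow> Complete_Partial_Order.chain (\<le>) C \<Longrightarrow> countable C"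
    and "\<And>A. A \<subseteq> T \<Longrightarrow> antichain A \<Longrightarrow> countable A"
  shows "f_Type_I (tree_topology T)"
  unfolding f_Type_I_def
proof (intro exI conjI allI)
  show "continuous_map (tree_topology T) euclidean (\<lambda>x. longray_of (tree_rank T x))"
    by (rule continuous_map_tree_rank[OF assms(1,2)])
  fix \<alpha>
  show "Lindelof_space (subtopology (tree_topology T)
      {x \<in> topspace (tree_topology T). longray_of (tree_rank T x) \<le> longray_of \<alpha>})"
    using countable_tree_rank_le[OF assms, of \<alpha>]
    by (intro countable_imp_Lindelof_space)
      (auto simp: longray_of_le_iff elim: countable_subset[rotated])
qed

section \<open>Gluing along a cone, and f-narrow sets\<close>

lemma continuous_map_if_clopen:
  assumes "openin X {x \<in> topspace X. P x}" "openin X {x \<in> topspace X. \<not> P x}"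
    and "continuous_map X Y f" "continuous_map X Y g"
  shows "continuous_map X Y (\<lambda>x. if P x then f x else g x)"
  unfolding continuous_map
proof (intro conjI allI impI)
  show "(\<lambda>x. if P x then f x else g x) ` topspace X \<subseteq> topspace Y"
    using assms(3,4) by (auto simp: continuous_map)
  fix U assume U: "openin Y U"
  have "{x \<in> topspace X. (if P x then f x else g x) \<in> U} =
      ({x \<in> topspace X. P x} \<inter> {x \<in> topspace X. f x \<in> U}) \<union>
      ({x \<in> topspace X. \<not> P x} \<inter> {x \<in> topspace X. g x \<in> U})"
    by auto
  then show "openin X {x \<in> topspace X. (if P x then f x else g x) \<in> U}"
    using assms(1,2) openin_continuous_map_preimage[OF assms(3) U]
      openin_continuous_map_preimage[OF assms(4) U] by auto
qed

text \<open>A function built from a splitting cone defeats both alternatives of f-narrowness: on the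
  part of \<open>D\<close> in the cone it is unbounded, and the rest of \<open>D\<close> lies in a
  single sublevel set, which is thus uncountable and not Lindelof.\<close>

lemma f_narrow_tree_imp_countable:
  assumes "tree T" "\<And>C. C \<subseteq> T \<Longrightarrow> Complete_Partial_Order.chain (\<le>) C \<Longrightarrow> countable C"
    and "\<And>A. A \<subseteq> T \<Longrightarrow> antichain A \<Longrightarrow> countable A"
    and "f_narrow (tree_topology T) D"
  shows "countable D"
proof (rule ccontr)
  assume "uncountable D"
  have DT: "D \<subseteq> T"
    using assms(4) closedin_subset[of "tree_topology T" D] by (simp add: f_narrow_def)
  then obtain x where x: "x \<in> T" "uncountable {z \<in> D. x < z}" "uncountable {z \<in> D. \<not> x < z}"
    using uncountable_split_by_cone[OF assms(1-3) _ \<open>uncountable D\<close>] by blast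
  \<comment> \<open>Any ordinal will do: it is the value off the cone and also the level at which
    the Lindelof alternative is tested.\<close>
  fix \<gamma> :: omega1
  define f where "f z = (if x < z then longray_of (tree_rank T z) else longray_of \<gamma>)" for z
  have "continuous_map (tree_topology T) euclidean f"
    unfolding f_def
    by (rule continuous_map_if_clopen)
      (simp_all add: openin_tree_cone[OF assms(1) x(1)] openin_tree_complement_cone[OF assms(1)]
        continuous_map_tree_rank[OF assms(1,2)])
  then consider b where "f ` D \<subseteq> {..<b}"
    | "Lindelof_space (subtopology (tree_topology T) {z \<in> D. f z \<le> longray_of \<gamma>})"
    using assms(4) unfolding f_narrow_def by blast
  then show False
  proof cases
    case 1
    have "{z \<in> D. x < z} \<subseteq> {z \<in> T. tree_rank T z \<le> fst (Rep_longray b)}"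
    proof
      fix z assume z: "z \<in> {z \<in> D. x < z}"
      then have "f z < b" using 1 by auto
      then show "z \<in> {z \<in> T. tree_rank T z \<le> fst (Rep_longray b)}"
        using z DT longray_of_less_imp by (auto simp: f_def)
    qed
    then have "countable {z \<in> D. x < z}"
      by (rule countable_subset) (rule countable_tree_rank_le[OF assms(1-3)])
    then show False using x(2) by contradiction
  next
    case 2
    have "countable {z \<in> D. f z \<le> longray_of \<gamma>}"
      by (rule Lindelof_tree_imp_countable[OF assms(1,2) _ 2]) (use DT in auto)
    then have "countable {z \<in> D. \<not> x < z}"
      by (rule countable_subset[rotated]) (auto simp: f_def)
    then show False using x(3) by blast
  qed
qed

theorem mainTheorem6:
  fixes T :: "'a::order set"
  assumes "Suslin_tree T"
    and "Hausdorff_space (tree_topology T)"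
  shows "omega1_compact (tree_topology T) \<and>
    locally_compact_space (tree_topology T) \<and>
    first_countable (tree_topology T) \<and>
    f_Type_I (tree_topology T) \<and>
    \<not> (\<exists>D. closedin (tree_topology T) D \<and>
               \<not> Lindelof_space (subtopology (tree_topology T) D) \<and>
               f_narrow (tree_topology T) D)"
proof -
  have T: "tree T"
    and chains: "\<And>C. C \<subseteq> T \<Longrightarrow> Complete_Partial_Order.chain (\<le>) C \<Longrightarrow> countable C"
    and antichains: "\<And>A. A \<subseteq> T \<Longrightarrow> antichain A \<Longrightarrow> countable A"
    using assms(1) unfolding Suslin_tree_def by blast+
  \<comment> \<open>This is the last conjunct in contrapositive form, since countable spaces are
    Lindelof.\<close>
  have "Lindelof_space (subtopology (tree_topology T) D)" if "f_narrow (tree_topology T) D" for D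
    using f_narrow_tree_imp_countable[OF T chains antichains that]
    by (intro countable_imp_Lindelof_space) simp
  then show ?thesis
    using omega1_compact_tree[OF T antichains] locally_compact_space_tree[OF T]
      first_countable_tree[OF T chains] f_Type_I_tree[OF T chains antichains] by blast
qed

end
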